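(* Let $\|\cdot\|$ be a smooth and strictly convex norm on $\mathbb{R}^n$. A convex function $f:\mathbb{R}^n\to\mathbb{R}$ is differentiable at $x\in\mathbb{R}^n$ if and only if its norm sub-differential $\partial f(x)$ is a singleton. In this case, the unique norm sub-gradient of $f$ at $x$ is the norm gradient $\nabla f(x)$, and $$df_x(u)=\mathcal{L}(\nabla f(x))\cdot u$$ for every $u\in\mathbb{R}^n$.
   Context: A norm is smooth if its unit ball $B=\{x:\|x\|\le 1\}$ has a unique supporting hyperplane at each boundary point, and strictly convex if $\partial B$ contains no (non-degenerate) line segment. A hyperplane supports a closed convex set $C$ at $x\in\partial C$ if $C$ is contained in one of the closed half-spaces determined by the translate of the hyperplane through $x$. Birkhoff orthogonality: $x\dashv_B y$ means $\|x+ty\|\ge\|x\|$ for all $t\in\mathbb{R}$; for a hyperplane $\mathbf{h}$ (taken through the origin), $x\dashv_B\mathbf{h}$ means $x\dashv_B z$ for all $z\in\mathbf{h}$; then $x$ is Birkhoff left-orthogonal to $\mathbf{h}$ and $\mathbf{h}$ is Birkhoff right-orthogonal to $x$. Legendre transform: $\mathcal{L}:\mathbb{R}^n\to(\mathbb{R}^n)^*$ sends $x\ne 0$ to the unique linear functional $\mathcal{L}(x)$ whose kernel is the (unique) hyperplane Birkhoff right-orthogonal to $x$ and with $\mathcal{L}(x)\cdot x=\|x\|^2$; $\mathcal{L}(0)=0$. A vector $v$ is a norm sub-gradient of $f$ at $x$ if $f(y)-f(x)\ge\mathcal{L}(v)\cdot(y-x)$ for all $y\in\mathbb{R}^n$;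 the norm sub-differential $\partial f(x)$ is the set of all norm sub-gradients of $f$ at $x$. Norm gradient: let $f:\mathbb{R}^n\to\mathbb{R}$ be convex and (Fréchet) differentiable at $x$, and put $c=f(x)$. If $c$ is not the global minimum of $f$, then $\nabla f(x)$ is the unique non-zero vector such that (a) $\nabla f(x)$ is Birkhoff left-orthogonal to the (unique) supporting hyperplane of the sub-level set $\{f\le c\}$ at $x$, and (b) $df_x(\nabla f(x))=\|\nabla f(x)\|^2$. If $c$ is the global minimum, $\nabla f(x)=0$. *)

theory Defs
  imports "HOL-Analysis.Analysis"
begin

text \<open>
  The norm under consideration is an arbitrary function \<open>N\<close> satisfying the norm axioms; it is
  unrelated to the Euclidean \<open>norm\<close> of the type \<open>real ^ 'n\<close>. Topological notions and the Frechet
  derivative are those of the Euclidean norm, which agree with those of \<open>N\<close> since all norms on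
  a finite-dimensional space are equivalent.
\<close>

definition is_norm :: "(real ^ 'n \<Rightarrow> real) \<Rightarrow> bool" where
  "is_norm N \<longleftrightarrow>
     (\<forall>x. 0 \<le> N x) \<and> (\<forall>x. N x = 0 \<longleftrightarrow> x = 0) \<and>
     (\<forall>c x. N (c *\<^sub>R x) = \<bar>c\<bar> * N x) \<and>
     (\<forall>x y. N (x + y) \<le> N x + N y)"

definition unit_ball :: "(real ^ 'n \<Rightarrow> real) \<Rightarrow> (real ^ 'n) set" where
  "unit_ball N = {x. N x \<le> 1}"

definition linear_hyperplane :: "(real ^ 'n) set \<Rightarrow> bool" where
  "linear_hyperplane h \<longleftrightarrow> (\<exists>a. a \<noteq> 0 \<and> h = {z. a \<bullet> z = 0})"

text \<open>
  Supporting hyperplanes are represented by their translates through the origin. The two closed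
  half-spaces bounded by \<open>x + h\<close> arise from the two normal directions \<open>a\<close> and \<open>- a\<close> of \<open>h\<close>.
\<close>

definition supports_at :: "(real ^ 'n) set \<Rightarrow> (real ^ 'n) set \<Rightarrow> real ^ 'n \<Rightarrow> bool" where
  "supports_at h C x \<longleftrightarrow>
     x \<in> frontier C \<and>
     (\<exists>a. a \<noteq> 0 \<and> h = {z. a \<bullet> z = 0} \<and> C \<subseteq> {y. a \<bullet> y \<le> a \<bullet> x})"

definition smooth_norm :: "(real ^ 'n \<Rightarrow> real) \<Rightarrow> bool" where
  "smooth_norm N \<longleftrightarrow> (\<forall>x \<in> frontier (unit_ball N). \<exists>!h. supports_at h (unit_ball N) x)"

definition strictly_convex_norm :: "(real ^ 'n \<Rightarrow> real) \<Rightarrow> bool" where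
  "strictly_convex_norm N \<longleftrightarrow>
     \<not> (\<exists>a b. a \<noteq> b \<and> closed_segment a b \<subseteq> frontier (unit_ball N))"

definition birkhoff_orth :: "(real ^ 'n \<Rightarrow> real) \<Rightarrow> real ^ 'n \<Rightarrow> real ^ 'n \<Rightarrow> bool" where
  "birkhoff_orth N x y \<longleftrightarrow> (\<forall>t::real. N (x + t *\<^sub>R y) \<ge> N x)"

definition birkhoff_orth_set :: "(real ^ 'n \<Rightarrow> real) \<Rightarrow> real ^ 'n \<Rightarrow> (real ^ 'n) set \<Rightarrow> bool" where
  "birkhoff_orth_set N x h \<longleftrightarrow> (\<forall>z \<in> h. birkhoff_orth N x z)"

text \<open>
  The dual space consists of the linear maps to \<open>real\<close>. Existence and uniqueness of the functional
  below hold for smooth norms; otherwise the description operator may be unspecified.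
\<close>

definition legendre :: "(real ^ 'n \<Rightarrow> real) \<Rightarrow> real ^ 'n \<Rightarrow> (real ^ 'n \<Rightarrow> real)" where
  "legendre N x =
     (if x = 0 then (\<lambda>_. 0)
      else (THE \<phi>. linear \<phi> \<and>
              {z. \<phi> z = 0} = (THE h. linear_hyperplane h \<and> birkhoff_orth_set N x h) \<and>
              \<phi> x = (N x)\<^sup>2))"

definition norm_subgradient ::
    "(real ^ 'n \<Rightarrow> real) \<Rightarrow> (real ^ 'n \<Rightarrow> real) \<Rightarrow> real ^ 'n \<Rightarrow> real ^ 'n \<Rightarrow> bool" where
  "norm_subgradient N f x v \<longleftrightarrow> (\<forall>y. f y - f x \<ge> legendre N v (y - x))"

definition norm_subdifferential ::
    "(real ^ 'n \<Rightarrow> real) \<Rightarrow> (real ^ 'n \<Rightarrow> real) \<Rightarrow> real ^ 'n \<Rightarrow> (real ^ 'n) set" where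
  "norm_subdifferential N f x = {v. norm_subgradient N f x v}"

text \<open>Meaningful for \<open>N\<close> smooth and strictly convex and \<open>f\<close> convex and differentiable at \<open>x\<close>.\<close>

definition norm_gradient ::
    "(real ^ 'n \<Rightarrow> real) \<Rightarrow> (real ^ 'n \<Rightarrow> real) \<Rightarrow> real ^ 'n \<Rightarrow> real ^ 'n" where
  "norm_gradient N f x =
     (if \<forall>y. f x \<le> f y then 0
      else (THE v. v \<noteq> 0 \<and>
              birkhoff_orth_set N v (THE h. supports_at h {y. f y \<le> f x} x) \<and>
              frechet_derivative f (at x) v = (N v)\<^sup>2))"

end

theory Submission
  imports Defs
begin

text \<open>
  The Legendre transform of a smooth norm sends \<open>v\<close> to the only functional \<open>\<phi>\<close> with
  \<open>\<phi> v = (N v)\<^sup>2\<close> whose dual norm is at most \<open>N v\<close>; for a smooth and strictly convex norm it is a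
  bijection onto the dual space. Norm sub-gradients therefore correspond one-to-one to ordinary
  sub-gradients, and the claim reduces to the classical fact that a convex function is differentiable
  exactly where it has a single sub-gradient. At a point that is not a minimum, the kernel of the
  differential is the only hyperplane supporting the sub-level set, so the vector whose Legendre
  transform is the differential satisfies the characterisation of the norm gradient.
\<close>

section \<open>Sub-gradients and differentiability of convex functions on Euclidean spaces\<close>

lemma inner_functional_eq_iff: "(\<lambda>u. a \<bullet> u) = (\<lambda>u. b \<bullet> u) \<longleftrightarrow> a = b"
  by (simp only: fun_eq_iff vector_eq_rdot)

text \<open>A Hahn-Banach statement: an affine minorant along one line extends to the whole space.
  Slope 0 in direction 0 gives existence of a sub-gradient; a slope steeper than that of a known
  sub-gradient gives a second one.\<close>

lemma convex_on_subgradient_in_direction: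
  fixes f :: "'a::euclidean_space \<Rightarrow> real"
  assumes f: "convex_on UNIV f" and le: "\<And>t. f x + t * c \<le> f (x + t *\<^sub>R u)"
  obtains a where "a \<bullet> u = c" "\<And>y. f x + a \<bullet> (y - x) \<le> f y"
proof -
  define E where "E = {p. f (fst p) < (snd p :: real)}"
  define L where "L = range (\<lambda>t. (x + t *\<^sub>R u, f x + t * c))"
  \<comment> \<open>A hyperplane separating the strict epigraph from the line is the graph of the sub-gradient.\<close>
  have convE: "convex E"
  proof (rule convexI)
    fix p q :: "'a \<times> real" and s t :: real
    assume pq: "p \<in> E" "q \<in> E" and st: "0 \<le> s" "0 \<le> t" "s + t = 1"
    have "f (s *\<^sub>R fst p + t *\<^sub>R fst q) \<le> s * f (fst p) + t * f (fst q)"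
      using f st by (simp add: convex_on_def)
    also have "\<dots> < s * snd p + t * snd q"
    proof (cases "s = 0")
      case False
      then have "s * f (fst p) < s * snd p" using pq st by (simp add: E_def)
      moreover have "t * f (fst q) \<le> t * snd q"
        using pq st by (intro mult_left_mono) (auto simp: E_def)
      ultimately show ?thesis by simp
    qed (use pq st in \<open>simp add: E_def\<close>)
    finally show "s *\<^sub>R p + t *\<^sub>R q \<in> E" by (simp add: E_def)
  qed
  have convL: "convex L"
  proof (rule convexI)
    fix p q and s t :: real
    assume pq: "p \<in> L" "q \<in> L" and st: "0 \<le> s" "0 \<le> t" "s + t = 1"
    from pq obtain i j where p: "p = (x + i *\<^sub>R u, f x + i * c)" and q: "q = (x + j *\<^sub>R u, f x + j * c)"
      by (auto simp: L_def)
    have s: "s = 1 - t" using st by simp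
    have "s *\<^sub>R p + t *\<^sub>R q = (x + (s * i + t * j) *\<^sub>R u, f x + (s * i + t * j) * c)"
      unfolding p q s by (simp add: algebra_simps)
    then show "s *\<^sub>R p + t *\<^sub>R q \<in> L" by (auto simp: L_def)
  qed
  have "(x, f x + 1) \<in> E" by (simp add: E_def)
  then have "E \<noteq> {}" by blast
  moreover have "L \<noteq> {}" by (simp add: L_def)
  moreover have "E \<inter> L = {}" by (auto simp: E_def L_def leD[OF le])
  ultimately obtain n k where n: "n \<noteq> 0" and nE: "\<And>p. p \<in> E \<Longrightarrow> n \<bullet> p \<le> k"
    and nL: "\<And>p. p \<in> L \<Longrightarrow> k \<le> n \<bullet> p"
    using separating_hyperplane_sets[OF convE convL] by metis
  obtain w b where wb: "n = (w, b)" by fastforce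
  have E: "w \<bullet> y + b * r \<le> k" if "f y < r" for y r
    using nE[of "(y, r)"] that by (simp add: E_def wb)
  have L: "k \<le> w \<bullet> x + b * f x + t * (w \<bullet> u + b * c)" for t
  proof -
    have "(x + t *\<^sub>R u, f x + t * c) \<in> L" unfolding L_def by (rule rangeI)
    from nL[OF this] show ?thesis by (simp add: wb algebra_simps)
  qed
  \<comment> \<open>An affine function of \<open>t\<close> that is bounded below has slope 0;
    otherwise the chosen \<open>t\<close> would give it the value \<open>k - 1\<close>.\<close>
  have dir: "w \<bullet> u + b * c = 0"
  proof (rule ccontr)
    assume "w \<bullet> u + b * c \<noteq> 0"
    then show False
      using L[of "(k - 1 - (w \<bullet> x + b * f x)) / (w \<bullet> u + b * c)"] by simp
  qed
  then have k: "k \<le> w \<bullet> x + b * f x" using L[of 0] by simp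
  \<comment> \<open>The hyperplane is not vertical: for \<open>b = 0\<close> the bound at
    \<open>x + w\<close> would force \<open>w = 0\<close>, hence \<open>n = 0\<close>.\<close>
  have "b < 0"
  proof (rule ccontr)
    assume "\<not> b < 0"
    moreover have "b \<le> 0" using E[of x "f x + 1"] k by (simp add: algebra_simps)
    ultimately have b: "b = 0" by simp
    have "w \<bullet> w \<le> 0" using E[of "x + w" "f (x + w) + 1"] k b by (simp add: algebra_simps)
    moreover have "0 < w \<bullet> w" using n wb b by (simp add: zero_prod_def)
    ultimately show False by simp
  qed
  show thesis
  proof
    show "((-1 / b) *\<^sub>R w) \<bullet> u = c" using dir \<open>b < 0\<close> by (simp add: field_simps)
    fix y
    \<comment> \<open>The epigraph is strict, so the bound holds for every \<open>r\<close> above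
      \<open>f y\<close> and reaches \<open>f y\<close> by density.\<close>
    have "w \<bullet> (y - x) - b * f x \<le> r * (- b)" if "f y < r" for r
      using E[OF that] k by (simp add: algebra_simps)
    then have "(w \<bullet> (y - x) - b * f x) / (- b) \<le> r" if "f y < r" for r
      using \<open>b < 0\<close> that by (subst pos_divide_le_eq) auto
    then have "(w \<bullet> (y - x) - b * f x) / (- b) \<le> f y"
      by (rule dense_ge)
    moreover have "(w \<bullet> (y - x) - b * f x) / (- b) = f x + ((-1 / b) *\<^sub>R w) \<bullet> (y - x)"
      using \<open>b < 0\<close> by (simp add: field_simps)
    ultimately show "f x + ((-1 / b) *\<^sub>R w) \<bullet> (y - x) \<le> f y" by simp
  qed
qed

text \<open>\<open>f\<close> minus its affine minorant has a minimum at \<open>x\<close>, so the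
  derivative of the difference vanishes.\<close>

lemma has_derivative_subgradient_unique:
  fixes f :: "'a::euclidean_space \<Rightarrow> real"
  assumes D: "(f has_derivative D) (at x)" and a: "\<And>y. f x + a \<bullet> (y - x) \<le> f y"
  shows "D = (\<lambda>u. a \<bullet> u)"
proof -
  have "((\<lambda>y. f y - a \<bullet> (y - x)) has_derivative (\<lambda>u. D u - a \<bullet> u)) (at x)"
    by (auto intro!: derivative_eq_intros D)
  moreover have "f x - a \<bullet> (x - x) \<le> f y - a \<bullet> (y - x)" for y
    using a[of y] by simp
  ultimately have "(\<lambda>u. D u - a \<bullet> u) = (\<lambda>u. 0)"
    by (intro has_derivative_local_min[of "\<lambda>y. f y - a \<bullet> (y - x)"]) auto
  then show ?thesis by (auto simp: fun_eq_iff)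
qed

text \<open>The lower estimate for the derivative is the sub-gradient inequality itself. The upper
  one comes from uniqueness, first along rays and then along both sides of each coordinate
  axis.\<close>

lemma convex_on_unique_subgradient_imp_has_derivative:
  fixes f :: "'a::euclidean_space \<Rightarrow> real"
  assumes f: "convex_on UNIV f" and a: "\<And>y. f x + a \<bullet> (y - x) \<le> f y"
    and uniq: "\<And>a'. (\<And>y. f x + a' \<bullet> (y - x) \<le> f y) \<Longrightarrow> a' = a"
  shows "(f has_derivative (\<lambda>u. a \<bullet> u)) (at x)"
proof -
  \<comment> \<open>If \<open>f\<close> grew faster than \<open>a \<bullet> u + e\<close> along \<open>u\<close>, separation would give a second sub-gradient.\<close>
  have direction: "\<exists>d>0. \<forall>s. 0 \<le> s \<longrightarrow> s \<le> d \<longrightarrow> f (x + s *\<^sub>R u) \<le> f x + s * (a \<bullet> u + e)"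
    if "e > 0" for u e
  proof -
    have "\<exists>t>0. f (x + t *\<^sub>R u) < f x + t * (a \<bullet> u + e)"
    proof (rule ccontr)
      assume none: "\<not> (\<exists>t>0. f (x + t *\<^sub>R u) < f x + t * (a \<bullet> u + e))"
      \<comment> \<open>The separation lemma asks for a whole line; for non-positive
        \<open>t\<close> the sub-gradient \<open>a\<close> provides the bound, since
        \<open>t * e\<close> is then non-positive.\<close>
      have "f x + t * (a \<bullet> u + e) \<le> f (x + t *\<^sub>R u)" for t
      proof (cases "t > 0")
        case False
        then have "t * e \<le> 0" using \<open>e > 0\<close> by (simp add: mult_nonpos_nonneg)
        then show ?thesis using a[of "x + t *\<^sub>R u"] by (simp add: algebra_simps)
      qed (use none in force)
      then obtain a' where "a' \<bullet> u = a \<bullet> u + e" "\<And>y. f x + a' \<bullet> (y - x) \<le> f y"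
        using convex_on_subgradient_in_direction[OF f] by blast
      then show False using uniq \<open>e > 0\<close> by force
    qed
    then obtain t where t: "t > 0" "f (x + t *\<^sub>R u) < f x + t * (a \<bullet> u + e)" by blast
    \<comment> \<open>One good step \<open>t\<close> serves all smaller ones by convexity;
      \<open>r\<close> is the weight of the far end point.\<close>
    have "f (x + s *\<^sub>R u) \<le> f x + s * (a \<bullet> u + e)" if s: "0 \<le> s" "s \<le> t" for s
    proof -
      define r where "r = s / t"
      have r: "0 \<le> r" "r \<le> 1" "r * t = s" using s t by (auto simp: r_def)
      have "x + s *\<^sub>R u = (1 - r) *\<^sub>R x + r *\<^sub>R (x + t *\<^sub>R u)"
        by (simp add: algebra_simps flip: r(3))
      then have "f (x + s *\<^sub>R u) \<le> (1 - r) * f x + r * f (x + t *\<^sub>R u)"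
        using convex_onD[OF f r(1,2)] by simp
      also have "\<dots> \<le> (1 - r) * f x + r * (f x + t * (a \<bullet> u + e))"
        using t r by (intro add_left_mono mult_left_mono) auto
      finally show ?thesis by (simp add: algebra_simps flip: r(3))
    qed
    then show ?thesis using t by blast
  qed
  have axis: "\<exists>d>0. \<forall>s. \<bar>s\<bar> \<le> d \<longrightarrow> f (x + s *\<^sub>R b) \<le> f x + s * (a \<bullet> b) + \<bar>s\<bar> * e"
    if e: "e > 0" for b e
  proof -
    obtain d where d: "d > 0" "\<And>s. 0 \<le> s \<Longrightarrow> s \<le> d \<Longrightarrow> f (x + s *\<^sub>R b) \<le> f x + s * (a \<bullet> b + e)"
      using direction[OF e] by blast
    obtain d' where d': "d' > 0"
      "\<And>s. 0 \<le> s \<Longrightarrow> s \<le> d' \<Longrightarrow> f (x + s *\<^sub>R - b) \<le> f x + s * (a \<bullet> - b + e)"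
      using direction[OF e] by blast
    have "f (x + s *\<^sub>R b) \<le> f x + s * (a \<bullet> b) + \<bar>s\<bar> * e" if "\<bar>s\<bar> \<le> min d d'" for s
      using d(2)[of s] d'(2)[of "-s"] that by (cases "s \<ge> 0") (auto simp: algebra_simps)
    then show ?thesis using d(1) d'(1) by (intro exI[of _ "min d d'"]) auto
  qed
  \<comment> \<open>\<open>y\<close> will be an average of \<open>n\<close> points whose offsets
    from \<open>x\<close> are \<open>n\<close> times the components of \<open>y - x\<close>; the
    tolerance \<open>e / n\<close> and the radius \<open>m / n\<close> absorb this factor.\<close>
  define n where "n = real DIM('a)"
  have n: "n > 0" by (simp add: n_def)
  show ?thesis
    unfolding has_derivative_at_alt
  proof (intro conjI allI impI)
    show "bounded_linear (\<lambda>u. a \<bullet> u)" by (rule bounded_linear_inner_right)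
    fix e :: real assume "e > 0"
    then have "e / n > 0" using n by simp
    then obtain d where d: "\<And>b. d b > 0"
      "\<And>b s. \<bar>s\<bar> \<le> d b \<Longrightarrow> f (x + s *\<^sub>R b) \<le> f x + s * (a \<bullet> b) + \<bar>s\<bar> * (e / n)"
      using axis by metis
    define m where "m = Min (d ` Basis)"
    have m: "m > 0" "\<And>b. b \<in> Basis \<Longrightarrow> m \<le> d b" using d(1) by (auto simp: m_def)
    show "\<exists>d>0. \<forall>y. norm (y - x) < d \<longrightarrow> norm (f y - f x - a \<bullet> (y - x)) \<le> e * norm (y - x)"
    proof (intro exI[of _ "m / n"] conjI allI impI)
      show "m / n > 0" using m n by simp
      fix y assume y: "norm (y - x) < m / n"
      define h where "h = y - x"
      have hb: "n * \<bar>h \<bullet> b\<bar> \<le> m" if "b \<in> Basis" for b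
      proof -
        have "n * \<bar>h \<bullet> b\<bar> \<le> n * norm h" using n that by (simp add: Basis_le_norm)
        also have "\<dots> \<le> m" using y n by (simp add: h_def field_simps)
        finally show ?thesis .
      qed
      have bound: "f (x + (n * (h \<bullet> b)) *\<^sub>R b) \<le> f x + n * (h \<bullet> b) * (a \<bullet> b) + norm h * e"
        if b: "b \<in> Basis" for b
      proof -
        have "\<bar>n * (h \<bullet> b)\<bar> * (e / n) = \<bar>h \<bullet> b\<bar> * e"
          using n by (simp add: abs_mult)
        also have "\<dots> \<le> norm h * e"
          using b \<open>e > 0\<close> by (intro mult_right_mono) (auto simp: Basis_le_norm)
        finally show ?thesis
          using d(2)[of "n * (h \<bullet> b)" b] hb[OF b] m(2)[OF b] n by (simp add: abs_mult)
      qed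
      have sum_const: "(\<Sum>b\<in>(Basis::'a set). (1 / n) * c) = c" for c :: real
        by (simp add: n_def)
      \<comment> \<open>\<open>y\<close> is an average of points on the coordinate axes through \<open>x\<close>, so convexity upgrades
        the bounds along the axes to a bound uniform in all directions.\<close>
      have "y = (\<Sum>b\<in>Basis. (1 / n) *\<^sub>R (x + (n * (h \<bullet> b)) *\<^sub>R b))"
      proof -
        have "(\<Sum>b\<in>Basis. (1 / n) *\<^sub>R (x + (n * (h \<bullet> b)) *\<^sub>R b))
            = (\<Sum>b\<in>(Basis::'a set). (1 / n) *\<^sub>R x) + (\<Sum>b\<in>Basis. (h \<bullet> b) *\<^sub>R b)"
          using n by (simp add: scaleR_right_distrib sum.distrib)
        also have "(\<Sum>b\<in>(Basis::'a set). (1 / n) *\<^sub>R x) = x"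
          by (simp add: n_def sum_constant_scaleR)
        finally show ?thesis by (simp add: euclidean_representation h_def)
      qed
      then have "f y \<le> (\<Sum>b\<in>Basis. (1 / n) * f (x + (n * (h \<bullet> b)) *\<^sub>R b))"
        using convex_on_sum[OF finite_Basis nonempty_Basis f,
            of "\<lambda>_. 1 / n" "\<lambda>b. x + (n * (h \<bullet> b)) *\<^sub>R b"] n sum_const[of 1]
        by simp
      also have "\<dots> \<le> (\<Sum>b\<in>Basis. (1 / n) * (f x + n * (h \<bullet> b) * (a \<bullet> b) + norm h * e))"
        using bound n by (intro sum_mono mult_left_mono) auto
      also have "\<dots> = (\<Sum>b\<in>(Basis::'a set). (1 / n) * (f x + norm h * e)) + (\<Sum>b\<in>Basis. (h \<bullet> b) * (a \<bullet> b))"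
        unfolding sum.distrib[symmetric] using n by (intro sum.cong) (auto simp: field_simps)
      also have "\<dots> = f x + norm h * e + a \<bullet> h"
        unfolding sum_const by (simp add: euclidean_inner[of a h] mult.commute)
      finally show "norm (f y - f x - a \<bullet> (y - x)) \<le> e * norm (y - x)"
        using a[of y] by (simp add: h_def mult.commute)
    qed
  qed
qed

lemma convex_on_differentiable_iff_unique_subgradient:
  fixes f :: "'a::euclidean_space \<Rightarrow> real"
  assumes f: "convex_on UNIV f"
  shows "f differentiable (at x) \<longleftrightarrow> (\<exists>!a. \<forall>y. f x + a \<bullet> (y - x) \<le> f y)"
proof
  assume "f differentiable (at x)"
  then obtain D where D: "(f has_derivative D) (at x)" by (auto simp: differentiable_def)
  obtain a where a: "\<And>y. f x + a \<bullet> (y - x) \<le> f y"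
    using convex_on_subgradient_in_direction[OF f, of x 0 0] by auto
  show "\<exists>!a. \<forall>y. f x + a \<bullet> (y - x) \<le> f y"
  proof (intro ex1I[of _ a] allI a)
    fix a' assume "\<forall>y. f x + a' \<bullet> (y - x) \<le> f y"
    then have "(\<lambda>u. a' \<bullet> u) = (\<lambda>u. a \<bullet> u)"
      using has_derivative_subgradient_unique[OF D] a by metis
    then show "a' = a" by (simp only: inner_functional_eq_iff)
  qed
next
  assume "\<exists>!a. \<forall>y. f x + a \<bullet> (y - x) \<le> f y"
  then show "f differentiable (at x)"
    using convex_on_unique_subgradient_imp_has_derivative[OF f]
    by (metis differentiableI)
qed

section \<open>Linear functionals and norms given by their axioms\<close>

lemma linear_functional_inner:
  fixes \<phi> :: "'a::euclidean_space \<Rightarrow> real"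
  assumes "linear \<phi>"
  obtains a where "\<phi> = (\<lambda>u. a \<bullet> u)"
proof
  show "\<phi> = (\<lambda>u. adjoint \<phi> 1 \<bullet> u)"
    using adjoint_works[OF assms, of _ 1] by (auto simp: inner_commute fun_eq_iff)
qed

lemma is_normD:
  assumes "is_norm N"
  shows "0 \<le> N x" and "N x = 0 \<longleftrightarrow> x = 0" and "N (c *\<^sub>R x) = \<bar>c\<bar> * N x"
    and "N (x + y) \<le> N x + N y"
  using assms by (auto simp: is_norm_def)

lemma is_norm_zero: "is_norm N \<Longrightarrow> N 0 = 0"
  by (simp add: is_normD)

lemma is_norm_pos: "is_norm N \<Longrightarrow> x \<noteq> 0 \<Longrightarrow> 0 < N x"
  by (simp add: is_normD order_less_le)

lemma is_norm_minus: "is_norm N \<Longrightarrow> N (- x) = N x"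
  using is_normD(3)[of N "-1" x] by simp

lemma is_norm_convex_on:
  fixes N :: "real ^ 'n \<Rightarrow> real"
  assumes "is_norm N"
  shows "convex_on UNIV N"
proof (rule convex_onI)
  fix t :: real and x y :: "real ^ 'n"
  assume "0 < t" "t < 1"
  then show "N ((1 - t) *\<^sub>R x + t *\<^sub>R y) \<le> (1 - t) * N x + t * N y"
    using is_normD(4)[OF assms, of "(1 - t) *\<^sub>R x" "t *\<^sub>R y"] by (simp add: is_normD[OF assms])
qed simp

lemma frontier_unit_ballI:
  assumes N: "is_norm N" and x: "N x = 1"
  shows "x \<in> frontier (unit_ball N)"
proof -
  have ball: "x \<in> unit_ball N" using x by (simp add: unit_ball_def)
  have "x \<notin> interior (unit_ball N)"
  proof
    assume "x \<in> interior (unit_ball N)"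
    then obtain e where e: "e > 0" "cball x e \<subseteq> unit_ball N" by (auto simp: mem_interior_cball)
    have "x \<noteq> 0" using x is_norm_zero[OF N] by auto
    \<comment> \<open>A radial step of Euclidean length \<open>e\<close> stays in the ball around
      \<open>x\<close> but raises \<open>N\<close> above 1.\<close>
    have "x + (e / norm x) *\<^sub>R x \<in> unit_ball N"
      using e \<open>x \<noteq> 0\<close> by (intro subsetD[OF e(2)]) (simp add: dist_norm)
    moreover have "N (x + (e / norm x) *\<^sub>R x) = \<bar>1 + e / norm x\<bar> * N x"
      using is_normD(3)[OF N, of "1 + e / norm x" x] by (simp add: scaleR_add_left)
    ultimately show False using x e(1) \<open>x \<noteq> 0\<close> by (simp add: unit_ball_def field_simps)
  qed
  then show ?thesis using ball closure_subset by (auto simp: frontier_def)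
qed

section \<open>Birkhoff orthogonality and the Legendre transform\<close>

text \<open>Both sides say that \<open>x\<close> minimises \<open>N\<close> on the affine hyperplane
  where \<open>\<phi>\<close> equals \<open>(N x)\<^sup>2\<close>: the right one by homogeneity,
  after scaling each \<open>z\<close> with \<open>\<phi> z > 0\<close> into that hyperplane.\<close>

lemma birkhoff_orth_set_kernel_iff:
  assumes N: "is_norm N" and \<phi>: "linear \<phi>" "\<phi> x = (N x)\<^sup>2" and x: "x \<noteq> 0"
  shows "birkhoff_orth_set N x {z. \<phi> z = 0} \<longleftrightarrow> (\<forall>z. \<phi> z \<le> N x * N z)"
proof
  have pos: "0 < N x" using is_norm_pos[OF N x] .
  assume orth: "birkhoff_orth_set N x {z. \<phi> z = 0}"
  show "\<forall>z. \<phi> z \<le> N x * N z"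
  proof
    fix z
    show "\<phi> z \<le> N x * N z"
    proof (cases "\<phi> z > 0")
      case True
      define c where "c = (N x)\<^sup>2 / \<phi> z"
      have c: "c > 0" "c * \<phi> z = (N x)\<^sup>2" using True pos by (auto simp: c_def)
      have "\<phi> (c *\<^sub>R z - x) = 0"
        using \<phi> c by (simp add: linear_diff linear_cmul)
      then have "N x \<le> N (x + 1 *\<^sub>R (c *\<^sub>R z - x))"
        using orth unfolding birkhoff_orth_set_def birkhoff_orth_def by blast
      then have "N x \<le> c * N z" using c is_normD(3)[OF N, of c z] by simp
      then have "N x * \<phi> z \<le> (c * N z) * \<phi> z" using True by simp
      also have "\<dots> = N x * (N x * N z)" using c(2) by (simp add: power2_eq_square mult_ac)
      finally show ?thesis using pos by simp
    next
      case False
      then show ?thesis using mult_nonneg_nonneg[OF is_normD(1)[OF N] is_normD(1)[OF N], of x z] by simp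
    qed
  qed
next
  assume bound: "\<forall>z. \<phi> z \<le> N x * N z"
  have "N x \<le> N (x + t *\<^sub>R z)" if "\<phi> z = 0" for z t
  proof -
    have "(N x)\<^sup>2 = \<phi> (x + t *\<^sub>R z)" using \<phi> that by (simp add: linear_add linear_cmul)
    then have "N x * N x \<le> N x * N (x + t *\<^sub>R z)" using bound by (metis power2_eq_square)
    then show ?thesis using is_norm_pos[OF N x] by simp
  qed
  then show "birkhoff_orth_set N x {z. \<phi> z = 0}"
    by (auto simp: birkhoff_orth_set_def birkhoff_orth_def)
qed

text \<open>Replaces the nested descriptions in \<open>legendre\<close> by a condition on the dual
  norm. Existence comes from a supporting hyperplane of the unit ball at \<open>x\<close>
  normalised, uniqueness from smoothness there. The case \<open>x = 0\<close> fits in because a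
  linear functional that is nowhere positive vanishes.\<close>

lemma legendre_eq_iff:
  fixes N :: "real ^ 'n \<Rightarrow> real"
  assumes N: "is_norm N" and smooth: "smooth_norm N"
  shows "legendre N x = \<phi> \<longleftrightarrow> linear \<phi> \<and> (\<forall>z. \<phi> z \<le> N x * N z) \<and> \<phi> x = (N x)\<^sup>2"
proof (cases "x = 0")
  case True
  have "\<phi> = (\<lambda>_. 0)" if "linear \<phi>" "\<forall>z. \<phi> z \<le> 0"
  proof
    fix z
    show "\<phi> z = 0" using that(2)[rule_format, of z] that(2)[rule_format, of "-z"]
      by (simp add: linear_neg[OF that(1)])
  qed
  moreover have "N 0 = 0" using is_norm_zero[OF N] .
  ultimately show ?thesis using True
    by (auto simp: legendre_def linear_zero)
next
  case x: False
  have pos: "0 < N x" using is_norm_pos[OF N x] .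
  define e where "e = (1 / N x) *\<^sub>R x"
  have xe: "x = N x *\<^sub>R e" using pos by (simp add: e_def)
  have "N e = 1" using x by (simp add: e_def is_normD[OF N])
  then have "\<exists>!h. supports_at h (unit_ball N) e"
    using smooth frontier_unit_ballI[OF N] unfolding smooth_norm_def by blast
  have e_frontier: "e \<in> frontier (unit_ball N)"
    using frontier_unit_ballI[OF N \<open>N e = 1\<close>] .
  let ?P = "\<lambda>\<phi>. linear \<phi> \<and> (\<forall>z. \<phi> z \<le> N x * N z) \<and> \<phi> x = (N x)\<^sup>2"
  let ?H = "\<lambda>h. linear_hyperplane h \<and> birkhoff_orth_set N x h"
  have ker_supports: "supports_at {z. \<phi> z = 0} (unit_ball N) e" if P: "?P \<phi>" for \<phi>
  proof -
    obtain a where a: "\<phi> = (\<lambda>u. a \<bullet> u)" using linear_functional_inner P by metis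
    have "a \<noteq> 0" using P pos by (auto simp: a)
    moreover have "a \<bullet> e = N x"
      using P pos by (simp add: a e_def power2_eq_square)
    moreover have "a \<bullet> y \<le> N x" if "N y \<le> 1" for y
    proof -
      have "a \<bullet> y \<le> N x * N y" using P by (simp add: a)
      also have "\<dots> \<le> N x" using that pos by simp
      finally show ?thesis .
    qed
    ultimately show ?thesis
      using e_frontier unfolding supports_at_def a by (auto simp: unit_ball_def)
  qed
  have ker_H: "?H {z. \<phi> z = 0}" if P: "?P \<phi>" for \<phi>
  proof -
    obtain a where a: "\<phi> = (\<lambda>u. a \<bullet> u)" using linear_functional_inner P by metis
    have "a \<noteq> 0" using P pos by (auto simp: a)
    then show ?thesis using birkhoff_orth_set_kernel_iff[OF N, of \<phi> x] P x
      by (auto simp: linear_hyperplane_def a)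
  qed
  have H_P: "\<exists>\<phi>. ?P \<phi> \<and> h = {z. \<phi> z = 0}" if H: "?H h" for h
  proof -
    obtain a where a: "a \<noteq> 0" "h = {z. a \<bullet> z = 0}" using H by (auto simp: linear_hyperplane_def)
    \<comment> \<open>Otherwise \<open>x\<close> would lie in \<open>h\<close>, and orthogonality
      with \<open>t = -1\<close> would compare \<open>N x\<close> with \<open>N 0\<close>.\<close>
    have "a \<bullet> x \<noteq> 0"
    proof
      assume "a \<bullet> x = 0"
      then have "N x \<le> N (x + (-1) *\<^sub>R x)"
        using H unfolding a birkhoff_orth_set_def birkhoff_orth_def by blast
      then show False using is_norm_zero[OF N] pos by simp
    qed
    \<comment> \<open>The factor keeps the kernel and normalises the value at
      \<open>x\<close>.\<close>
    define \<phi> where "\<phi> = (\<lambda>z. ((N x)\<^sup>2 / (a \<bullet> x)) * (a \<bullet> z))"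
    have lin: "linear \<phi>" unfolding \<phi>_def
      by (intro linearI) (simp_all add: algebra_simps add_divide_distrib)
    have h: "h = {z. \<phi> z = 0}" using pos \<open>a \<bullet> x \<noteq> 0\<close> by (auto simp: a \<phi>_def)
    have "\<phi> x = (N x)\<^sup>2" using \<open>a \<bullet> x \<noteq> 0\<close> by (simp add: \<phi>_def)
    then show ?thesis
      using birkhoff_orth_set_kernel_iff[OF N lin _ x] H lin h by auto
  qed
  \<comment> \<open>A supporting functional at \<open>e\<close> is bounded on the whole space by
    homogeneity; rescaling brings its dual norm to \<open>N x\<close>.\<close>
  have "\<exists>\<phi>. ?P \<phi>"
  proof -
    obtain a where a: "a \<noteq> 0" and ay: "\<And>y. N y \<le> 1 \<Longrightarrow> a \<bullet> y \<le> a \<bullet> e"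
      using ex1_implies_ex[OF \<open>\<exists>!h. supports_at h (unit_ball N) e\<close>]
      by (auto simp: supports_at_def unit_ball_def)
    have bound: "a \<bullet> z \<le> (a \<bullet> e) * N z" for z
    proof (cases "z = 0")
      case False
      then have "0 < N z" by (rule is_norm_pos[OF N])
      then have "N ((1 / N z) *\<^sub>R z) \<le> 1" using False by (simp add: is_normD[OF N])
      from ay[OF this] show ?thesis using \<open>0 < N z\<close> by (simp add: field_simps)
    qed (simp add: is_norm_zero[OF N])
    have "0 < a \<bullet> e"
    proof -
      have "0 < (a \<bullet> e) * N a" using bound[of a] a by (metis inner_gt_zero_iff order_less_le_trans)
      then show ?thesis using is_norm_pos[OF N a] by (simp add: zero_less_mult_iff)
    qed
    define \<phi> where "\<phi> = (\<lambda>z. (N x / (a \<bullet> e)) * (a \<bullet> z))"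
    have "linear \<phi>" unfolding \<phi>_def
      by (intro linearI) (simp_all add: algebra_simps add_divide_distrib)
    moreover have "\<phi> z \<le> N x * N z" for z
    proof -
      have "\<phi> z \<le> (N x / (a \<bullet> e)) * ((a \<bullet> e) * N z)"
        unfolding \<phi>_def using bound pos \<open>0 < a \<bullet> e\<close> by (intro mult_left_mono) auto
      then show ?thesis using \<open>0 < a \<bullet> e\<close> by simp
    qed
    moreover have "\<phi> x = (N x)\<^sup>2"
    proof -
      have "a \<bullet> x = N x * (a \<bullet> e)" by (subst xe) simp
      then show ?thesis using \<open>0 < a \<bullet> e\<close> by (simp add: \<phi>_def power2_eq_square)
    qed
    ultimately show ?thesis by blast
  qed
  then obtain \<psi> where \<psi>: "?P \<psi>" by blast
  \<comment> \<open>Smoothness enters here: all these kernels support the unit ball at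
    \<open>e\<close>, so they coincide.\<close>
  have ker_eq: "{z. \<phi> z = 0} = {z. \<psi> z = 0}" if "?P \<phi>" for \<phi>
    using ex1E[OF \<open>\<exists>!h. supports_at h (unit_ball N) e\<close>] ker_supports[OF that] ker_supports[OF \<psi>]
    by metis
  have "h = {z. \<psi> z = 0}" if H: "?H h" for h
  proof -
    obtain \<phi> where "?P \<phi>" and h: "h = {z. \<phi> z = 0}" using H_P[OF H] by blast
    from ker_eq[OF this(1)] show ?thesis unfolding h .
  qed
  with ker_H[OF \<psi>] have the_h: "(THE h. ?H h) = {z. \<psi> z = 0}"
    by (rule the_equality)
  \<comment> \<open>A functional is determined by its kernel and its value at one point outside:
    each \<open>z\<close> is a multiple of \<open>x\<close> plus a kernel element.\<close>
  have unique: "\<phi> = \<psi>"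
    if \<phi>: "linear \<phi>" "{z. \<phi> z = 0} = {z. \<psi> z = 0}" "\<phi> x = (N x)\<^sup>2" for \<phi>
  proof
    fix z
    have "\<psi> (z - (\<psi> z / (N x)\<^sup>2) *\<^sub>R x) = 0"
      using \<psi> pos by (simp add: linear_diff linear_cmul)
    then have "\<phi> (z - (\<psi> z / (N x)\<^sup>2) *\<^sub>R x) = 0" using \<phi>(2) by blast
    then show "\<phi> z = \<psi> z" using \<phi> pos by (simp add: linear_diff linear_cmul)
  qed
  have leg: "legendre N x = \<psi>"
    unfolding legendre_def the_h using x \<psi> by (simp, intro the_equality unique) auto
  moreover have "\<phi> = \<psi>" if P: "?P \<phi>"
    using unique[OF _ ker_eq[OF P]] P by simp
  ultimately show ?thesis using \<psi> by auto
qed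

text \<open>The form that matches the definition of the norm gradient, with the kernel as supporting
  hyperplane.\<close>

lemma legendre_eq_iff_birkhoff:
  assumes "is_norm N" "smooth_norm N" "v \<noteq> 0" "linear \<phi>"
  shows "legendre N v = \<phi> \<longleftrightarrow> birkhoff_orth_set N v {z. \<phi> z = 0} \<and> \<phi> v = (N v)\<^sup>2"
  using legendre_eq_iff[OF assms(1,2), of v \<phi>] birkhoff_orth_set_kernel_iff[OF assms(1,4) _ assms(3)]
    assms(4) by blast

text \<open>\<open>\<phi>\<close> attains its dual norm \<open>M\<close> in some direction
  \<open>e\<close>; the non-negative multiple of \<open>e\<close> with norm \<open>M\<close> is a
  preimage.\<close>

lemma legendre_surj:
  fixes N :: "real ^ 'n \<Rightarrow> real"
  assumes N: "is_norm N" and smooth: "smooth_norm N" and \<phi>: "linear \<phi>"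
  obtains v where "legendre N v = \<phi>"
proof -
  have contN: "continuous_on UNIV N"
    by (intro convex_on_continuous is_norm_convex_on N open_UNIV)
  have cont: "continuous_on (sphere 0 1) (\<lambda>z. \<phi> z / N z)"
  proof (intro continuous_on_divide)
    show "continuous_on (sphere 0 1) \<phi>" using \<phi> by (simp add: linear_continuous_on linear_conv_bounded_linear)
    show "continuous_on (sphere 0 1) N" using contN continuous_on_subset by blast
    show "\<forall>z\<in>sphere 0 1. N z \<noteq> 0" by (auto simp: is_normD[OF N])
  qed
  \<comment> \<open>The Euclidean sphere is compact, and the quotient depends only on the direction of \<open>z\<close>.\<close>
  obtain e :: "real ^ 'n" where "e \<in> sphere 0 1"
    and e: "\<And>z. z \<in> sphere 0 1 \<Longrightarrow> \<phi> z / N z \<le> \<phi> e / N e"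
    using continuous_attains_sup[OF compact_sphere _ cont] by (auto simp: sphere_eq_empty)
  define M where "M = \<phi> e / N e"
  have "e \<noteq> 0" using \<open>e \<in> sphere 0 1\<close> by auto
  then have pos: "0 < N e" by (rule is_norm_pos[OF N])
  have bound: "\<phi> z \<le> M * N z" for z
  proof (cases "z = 0")
    case False
    then have "0 < N z" by (rule is_norm_pos[OF N])
    have "\<phi> ((1 / norm z) *\<^sub>R z) / N ((1 / norm z) *\<^sub>R z) \<le> M"
      unfolding M_def using False by (intro e) simp
    moreover have "\<phi> ((1 / norm z) *\<^sub>R z) / N ((1 / norm z) *\<^sub>R z) = \<phi> z / N z"
      using False \<phi> by (simp add: is_normD[OF N] linear_cmul)
    ultimately show ?thesis using \<open>0 < N z\<close> by (simp add: field_simps)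
  qed (use \<phi> in \<open>simp add: is_norm_zero[OF N] linear_0\<close>)
  have "M \<ge> 0"
  proof -
    have "- (M * N e) \<le> M * N e"
      using bound[of "-e"] pos \<phi> by (simp add: M_def linear_neg is_norm_minus[OF N])
    then show ?thesis using pos by (simp add: zero_le_mult_iff)
  qed
  define v where "v = (M / N e) *\<^sub>R e"
  have "N v = M" using pos \<open>M \<ge> 0\<close> by (simp add: v_def is_normD(3)[OF N])
  moreover have "\<phi> v = M\<^sup>2"
    using \<phi> pos by (simp add: v_def linear_cmul M_def power2_eq_square)
  ultimately have "legendre N v = \<phi>"
    using \<phi> bound by (simp add: legendre_eq_iff[OF N smooth])
  then show thesis by (rule that)
qed

text \<open>Two preimages of one functional, once normalised, lie in the face of the unit ball on
  which the functional is maximal. The face contains the segment between them, against strict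
  convexity.\<close>

lemma legendre_inj:
  fixes N :: "real ^ 'n \<Rightarrow> real"
  assumes N: "is_norm N" and smooth: "smooth_norm N" and strict: "strictly_convex_norm N"
  shows "inj (legendre N)"
proof (rule injI, rule ccontr)
  fix v w assume eq: "legendre N v = legendre N w" and "v \<noteq> w"
  define \<phi> where "\<phi> = legendre N w"
  have lin: "linear \<phi>" and v: "\<And>z. \<phi> z \<le> N v * N z" "\<phi> v = (N v)\<^sup>2"
    and w: "\<And>z. \<phi> z \<le> N w * N z" "\<phi> w = (N w)\<^sup>2"
    using legendre_eq_iff[OF N smooth, of v \<phi>] legendre_eq_iff[OF N smooth, of w \<phi>] eq
    by (auto simp: \<phi>_def)
  have ge0: "0 \<le> N z" for z by (rule is_normD(1)[OF N])
  define r where "r = N v"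
  \<comment> \<open>Evaluating the bound of each vector at the other one yields both
    inequalities.\<close>
  have r: "N w = r"
    using v(1)[of w] w(1)[of v] v(2) w(2) ge0[of v] ge0[of w]
    by (simp add: r_def power2_eq_square) (smt (verit) mult_le_cancel_right)
  have "r \<noteq> 0"
    using \<open>v \<noteq> w\<close> r is_normD(2)[OF N] unfolding r_def by metis
  then have "r > 0" using ge0[of v] by (simp add: r_def)
  have seg: "closed_segment ((1 / r) *\<^sub>R v) ((1 / r) *\<^sub>R w) \<subseteq> frontier (unit_ball N)"
  proof
    fix p assume "p \<in> closed_segment ((1 / r) *\<^sub>R v) ((1 / r) *\<^sub>R w)"
    then obtain t where t: "0 \<le> t" "t \<le> 1"
      and p: "p = (1 - t) *\<^sub>R (1 / r) *\<^sub>R v + t *\<^sub>R (1 / r) *\<^sub>R w"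
      by (auto simp: closed_segment_def)
    have "N p \<le> (1 - t) * N ((1 / r) *\<^sub>R v) + t * N ((1 / r) *\<^sub>R w)"
      unfolding p by (intro convex_onD[OF is_norm_convex_on[OF N] t] UNIV_I)
    also have "\<dots> = 1"
      using \<open>r > 0\<close> r by (simp add: is_normD(3)[OF N] r_def)
    finally have "N p \<le> 1" .
    \<comment> \<open>\<open>\<phi>\<close> is constant on the segment, which bounds
      \<open>N p\<close> from below.\<close>
    moreover have "\<phi> p = r"
      using \<open>r > 0\<close> r v(2) w(2) unfolding p
      by (simp add: linear_add[OF lin] linear_cmul[OF lin] r_def power2_eq_square field_simps)
    then have "r \<le> r * N p" using v(1)[of p] by (simp add: r_def)
    then have "1 \<le> N p" using \<open>r > 0\<close> by simp
    ultimately show "p \<in> frontier (unit_ball N)" by (intro frontier_unit_ballI[OF N]) simp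
  qed
  moreover have "(1 / r) *\<^sub>R v \<noteq> (1 / r) *\<^sub>R w" using \<open>v \<noteq> w\<close> \<open>r > 0\<close> by simp
  ultimately show False using strict unfolding strictly_convex_norm_def by blast
qed

section \<open>Supporting hyperplanes of sub-level sets\<close>

text \<open>A supporting normal \<open>b\<close> is non-positive on the descent directions, where
  \<open>a \<bullet> u < 0\<close>, hence on their closure. This contains the kernel of
  \<open>a\<close>, a subspace, so \<open>b\<close> vanishes there and is a multiple of
  \<open>a\<close>.\<close>

lemma supports_at_sublevel_iff:
  fixes f :: "real ^ 'n \<Rightarrow> real"
  assumes D: "(f has_derivative (\<lambda>u. a \<bullet> u)) (at x)" and a: "\<And>y. f x + a \<bullet> (y - x) \<le> f y"
    and "a \<noteq> 0"
  shows "supports_at h {y. f y \<le> f x} x \<longleftrightarrow> h = {z. a \<bullet> z = 0}"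
proof
  assume "h = {z. a \<bullet> z = 0}"
  moreover have "{y. f y \<le> f x} \<subseteq> {y. a \<bullet> y \<le> a \<bullet> x}"
  proof safe
    fix y assume "f y \<le> f x"
    then show "a \<bullet> y \<le> a \<bullet> x" using a[of y] by (simp add: inner_diff_right)
  qed
  moreover have "x \<in> frontier {y. f y \<le> f x}"
  proof -
    have "x \<notin> interior {y. f y \<le> f x}"
    proof
      assume "x \<in> interior {y. f y \<le> f x}"
      then obtain e where e: "e > 0" "cball x e \<subseteq> {y. f y \<le> f x}" by (auto simp: mem_interior_cball)
      \<comment> \<open>By the sub-gradient inequality \<open>f\<close> grows along
        \<open>a\<close>, so this point would have to lie outside the sub-level set.\<close>
      have "x + (e / norm a) *\<^sub>R a \<in> {y. f y \<le> f x}"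
        using e \<open>a \<noteq> 0\<close> by (intro subsetD[OF e(2)]) (simp add: dist_norm)
      then have "(e / norm a) * (a \<bullet> a) \<le> 0" using a[of "x + (e / norm a) *\<^sub>R a"] by simp
      moreover have "0 < (e / norm a) * (a \<bullet> a)" using e(1) \<open>a \<noteq> 0\<close> by simp
      ultimately show False by simp
    qed
    then show ?thesis
      using closure_subset[of "{y. f y \<le> f x}"] by (auto simp: frontier_def)
  qed
  ultimately show "supports_at h {y. f y \<le> f x} x"
    using \<open>a \<noteq> 0\<close> unfolding supports_at_def by blast
next
  assume "supports_at h {y. f y \<le> f x} x"
  then obtain b where b: "b \<noteq> 0" "h = {z. b \<bullet> z = 0}"
    and sub: "\<And>y. f y \<le> f x \<Longrightarrow> b \<bullet> y \<le> b \<bullet> x"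
    by (auto simp: supports_at_def)
  \<comment> \<open>A small step along \<open>u\<close> decreases \<open>f\<close>, so it stays in
    the sub-level set.\<close>
  have neg: "b \<bullet> u \<le> 0" if u: "a \<bullet> u < 0" for u
  proof -
    have "((\<lambda>t. f (x + t *\<^sub>R u)) has_derivative (\<lambda>t. a \<bullet> (t *\<^sub>R u))) (at 0)"
      by (rule has_derivative_compose[of "\<lambda>t. x + t *\<^sub>R u" "\<lambda>t. t *\<^sub>R u" 0 UNIV f "\<lambda>u. a \<bullet> u"])
        (auto intro!: derivative_eq_intros D)
    then have "((\<lambda>t. f (x + t *\<^sub>R u)) has_real_derivative (a \<bullet> u)) (at 0)"
      by (simp add: has_field_derivative_def mult.commute[of _ "a \<bullet> u"])
    from DERIV_neg_dec_right[OF this u] obtain t where t: "t > 0" "f (x + t *\<^sub>R u) < f x"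
      by (metis add_0 field_lbound_gt_zero scaleR_zero_left add.right_neutral)
    then show ?thesis
      using sub[of "x + t *\<^sub>R u"] by (simp add: inner_add_right mult_le_0_iff)
  qed
  have "b \<bullet> u \<le> 0" if u: "a \<bullet> u = 0" for u
  proof -
    \<comment> \<open>Tilting \<open>u\<close> by a small multiple of \<open>- a\<close> makes it a
      descent direction.\<close>
    have small: "b \<bullet> u \<le> s * (b \<bullet> a)" if "s > 0" for s
      using neg[of "u - s *\<^sub>R a"] u that \<open>a \<noteq> 0\<close> by (simp add: inner_diff_right)
    have "b \<bullet> u \<le> 0 + e" if "e > 0" for e
    proof (cases "b \<bullet> a > 0")
      case True
      then show ?thesis using small[of "e / (b \<bullet> a)"] \<open>e > 0\<close> by simp
    next
      case False
      then show ?thesis using small[of 1] \<open>e > 0\<close> by simp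
    qed
    then show ?thesis by (rule field_le_epsilon)
  qed
  from this this[of "- _"] have ker: "b \<bullet> u = 0" if "a \<bullet> u = 0" for u
    using that by (simp add: order_antisym)
  define c where "c = (b \<bullet> a) / (a \<bullet> a)"
  have "b \<bullet> u = c * (a \<bullet> u)" for u
    using ker[of "u - ((a \<bullet> u) / (a \<bullet> a)) *\<^sub>R a"] \<open>a \<noteq> 0\<close>
    by (simp add: inner_diff_right c_def)
  moreover from this[of b] have "c \<noteq> 0" using b(1) by auto
  ultimately show "h = {z. a \<bullet> z = 0}" using b(2) by simp
qed

section \<open>Norm sub-gradients and the norm gradient\<close>

theorem corollary4p2:
  fixes N :: "real ^ 'n \<Rightarrow> real" and f :: "real ^ 'n \<Rightarrow> real" and x :: "real ^ 'n"
  assumes "is_norm N" and "smooth_norm N" and "strictly_convex_norm N"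
    and "convex_on UNIV f"
  shows "(f differentiable (at x) \<longleftrightarrow> is_singleton (norm_subdifferential N f x)) \<and>
         (f differentiable (at x) \<longrightarrow>
            norm_subdifferential N f x = {norm_gradient N f x} \<and>
            (\<forall>u. frechet_derivative f (at x) u = legendre N (norm_gradient N f x) u))"
proof -
  note N = \<open>is_norm N\<close> and smooth = \<open>smooth_norm N\<close>
  define G where "G = {a. \<forall>y. f x + a \<bullet> (y - x) \<le> f y}"
  \<comment> \<open>\<open>\<Lambda> v\<close> represents \<open>legendre N v\<close> through the
    inner product, so that norm sub-gradients become the preimage of the ordinary sub-gradients
    \<open>G\<close>.\<close>
  define \<Lambda> where "\<Lambda> = (\<lambda>v. THE a. legendre N v = (\<lambda>u. a \<bullet> u))"
  have \<Lambda>: "legendre N v = (\<lambda>u. \<Lambda> v \<bullet> u)" for v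
  proof -
    have "linear (legendre N v)" using legendre_eq_iff[OF N smooth] by blast
    then obtain a where a: "legendre N v = (\<lambda>u. a \<bullet> u)" by (rule linear_functional_inner)
    then have "\<Lambda> v = a"
      unfolding \<Lambda>_def by (intro the_equality) (simp_all only: inner_functional_eq_iff)
    then show ?thesis using a by simp
  qed
  have bij: "bij \<Lambda>"
  proof (rule bijI)
    show "inj \<Lambda>" using legendre_inj[OF assms(1-3)] by (simp add: inj_def \<Lambda>)
    show "surj \<Lambda>"
      unfolding surj_def
    proof
      fix a :: "real ^ 'n"
      have "linear (\<lambda>u. a \<bullet> u)" by (simp add: bounded_linear.linear bounded_linear_inner_right)
      then obtain v where "legendre N v = (\<lambda>u. a \<bullet> u)" by (rule legendre_surj[OF N smooth])
      then show "\<exists>v. a = \<Lambda> v" unfolding \<Lambda> inner_functional_eq_iff by blast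
    qed
  qed
  have subdiff: "norm_subdifferential N f x = \<Lambda> -` G"
    by (auto simp: norm_subdifferential_def norm_subgradient_def G_def \<Lambda> algebra_simps)
  have "is_singleton (\<Lambda> -` G) \<longleftrightarrow> is_singleton G"
    using bij by (simp add: is_singleton_altdef card_vimage_inj bij_is_inj bij_is_surj)
  moreover have "f differentiable (at x) \<longleftrightarrow> is_singleton G"
  proof -
    have "(\<exists>!a. a \<in> G) \<longleftrightarrow> is_singleton G"
      unfolding is_singleton_def set_eq_iff singleton_iff by metis
    then show ?thesis
      using convex_on_differentiable_iff_unique_subgradient[OF \<open>convex_on UNIV f\<close>]
      by (simp add: G_def)
  qed
  ultimately have iff: "f differentiable (at x) \<longleftrightarrow> is_singleton (norm_subdifferential N f x)"
    by (simp add: subdiff)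
  have "norm_subdifferential N f x = {norm_gradient N f x} \<and>
      (\<forall>u. frechet_derivative f (at x) u = legendre N (norm_gradient N f x) u)"
    if diff: "f differentiable (at x)"
  proof -
    from diff obtain v where v: "norm_subdifferential N f x = {v}"
      using iff by (auto simp: is_singleton_def)
    define a where "a = \<Lambda> v"
    have a: "f x + a \<bullet> (y - x) \<le> f y" for y
    proof -
      have "v \<in> \<Lambda> -` G" using v subdiff by simp
      then show ?thesis by (simp add: G_def a_def)
    qed
    have D: "frechet_derivative f (at x) = (\<lambda>u. a \<bullet> u)"
      using has_derivative_subgradient_unique[OF _ a] diff frechet_derivative_works by blast
    then have deriv: "(f has_derivative (\<lambda>u. a \<bullet> u)) (at x)"
      using diff frechet_derivative_works by metis
    have leg: "legendre N w = (\<lambda>u. a \<bullet> u) \<longleftrightarrow> w = v" for w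
      using legendre_inj[OF assms(1-3)] \<Lambda>[of v] by (auto simp: a_def inj_def)
    have "norm_gradient N f x = v"
    proof (cases "\<forall>y. f x \<le> f y")
      case True
      \<comment> \<open>\<open>legendre N 0\<close> is the zero functional, for which the
        sub-gradient inequality expresses minimality.\<close>
      then have "0 \<in> norm_subdifferential N f x"
        by (simp add: norm_subdifferential_def norm_subgradient_def legendre_def)
      then show ?thesis using v True by (simp add: norm_gradient_def)
    next
      case False
      then have "a \<noteq> 0" using a by force
      \<comment> \<open>The functional represented by \<open>a\<close> is non-zero at
        \<open>a\<close> itself, unlike \<open>legendre N 0\<close>.\<close>
      then have "v \<noteq> 0"
        using leg[of v] by (auto simp: legendre_def fun_eq_iff dest: spec[of _ a])
      have "(THE h. supports_at h {y. f y \<le> f x} x) = {z. a \<bullet> z = 0}"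
        using supports_at_sublevel_iff[OF deriv a \<open>a \<noteq> 0\<close>] by simp
      moreover have "linear (\<lambda>u. a \<bullet> u)" by (rule has_derivative_linear[OF deriv])
      \<comment> \<open>The defining conditions of the norm gradient say that the Legendre transform
        of \<open>w\<close> is the differential; injectivity then identifies
        \<open>w\<close>.\<close>
      then have "w \<noteq> 0 \<and> birkhoff_orth_set N w {z. a \<bullet> z = 0} \<and> a \<bullet> w = (N w)\<^sup>2 \<longleftrightarrow> w = v" for w
        using legendre_eq_iff_birkhoff[OF N smooth, of w "\<lambda>u. a \<bullet> u"] leg[of w] \<open>v \<noteq> 0\<close> by auto
      ultimately show ?thesis
        unfolding norm_gradient_def D if_not_P[OF False] by simp
    qed
    then show ?thesis using v D leg[of v] by simp
  qed
  then show ?thesis using iff by blast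
qed

end
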